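(* Let $R$ be a unital $*$-ring and let $a\in R$ be regular with an inner inverse $a^{-}$. Then the following conditions are equivalent: (i) $a$ is both group invertible and Moore-Penrose invertible. (ii) $a$ is both core invertible and dual core invertible. (iii) $u=aa^*a+1-aa^{-}$ is invertible. (iv) $v=aa^*a+1-a^{-}a$ is invertible. (v) $s=a^*a^2+1-a^{-}a$ is invertible. (vi) $t=a^2a^*+1-aa^{-}$ is invertible. In this case, $$a^{(\#)}=u^{-1}aa^*,\qquad a_{(\#)}=a^*av^{-1},$$ $$a^\dag=(t^{-1}a^2)^*=(a^2s^{-1})^*,$$ $$a^\#=(aa^*t^{-1})^2a=a(s^{-1}a^*a)^2.$$
   Context: A unital $*$-ring is an associative (not necessarily commutative) ring $R$ with unity $1$ and an involution $a\mapsto a^*$ satisfying $(a^* )^*=a$, $(a+b)^*=a^*+b^*$, $(ab)^*=b^*a^*$ for all $a,b\in R$. An element $a\in R$ is regular if there is $x\in R$ with $axa=a$; such an $x$ is called an inner inverse of $a$. The following inverses are unique when they exist. Group inverse $a^\#$: the $x$ with $axa=a$, $xax=x$, $ax=xa$. Moore-Penrose inverse $a^\dag$: the $x$ with $axa=a$, $xax=x$, $(ax)^*=ax$, $(xa)^*=xa$. Core inverse $a^{(\#)}$: the $x$ with $axa=a$, $xR=aR$, $Rx=Ra^*$. Dual core inverse $a_{(\#)}$: the $x$ with $axa=a$, $xR=a^*R$, $Rx=Ra$. An element is called group (resp. Moore-Penrose, core, dual core) invertible if the corresponding inverse exists. *)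

theory Defs
  imports Main
begin

text \<open>
  The sort \<^class>\<open>ring\<close> with \<^class>\<open>monoid_mult\<close> is used instead of \<^class>\<open>ring_1\<close>,
  because the latter assumes that 0 and 1 are distinct and so excludes the zero ring.
\<close>

class star_ring = ring + monoid_mult +
  fixes star :: "'a \<Rightarrow> 'a"  (\<open>(_\<^sup>\<star>)\<close> [1000] 999)
  assumes star_star: "(a\<^sup>\<star>)\<^sup>\<star> = a"
    and star_add: "(a + b)\<^sup>\<star> = a\<^sup>\<star> + b\<^sup>\<star>"
    and star_mult: "(a * b)\<^sup>\<star> = b\<^sup>\<star> * a\<^sup>\<star>"

definition is_inner_inverse :: "'a::star_ring \<Rightarrow> 'a \<Rightarrow> bool" where
  "is_inner_inverse a x \<longleftrightarrow> a * x * a = a"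

definition is_two_sided_inverse :: "'a::star_ring \<Rightarrow> 'a \<Rightarrow> bool" where
  "is_two_sided_inverse a x \<longleftrightarrow> a * x = 1 \<and> x * a = 1"

definition is_group_inverse :: "'a::star_ring \<Rightarrow> 'a \<Rightarrow> bool" where
  "is_group_inverse a x \<longleftrightarrow> a * x * a = a \<and> x * a * x = x \<and> a * x = x * a"

definition is_mp_inverse :: "'a::star_ring \<Rightarrow> 'a \<Rightarrow> bool" where
  "is_mp_inverse a x \<longleftrightarrow>
     a * x * a = a \<and> x * a * x = x \<and> (a * x)\<^sup>\<star> = a * x \<and> (x * a)\<^sup>\<star> = x * a"

definition right_principal :: "'a::star_ring \<Rightarrow> 'a set" where
  "right_principal a = {a * r | r. True}"

definition left_principal :: "'a::star_ring \<Rightarrow> 'a set" where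
  "left_principal a = {r * a | r. True}"

definition is_core_inverse :: "'a::star_ring \<Rightarrow> 'a \<Rightarrow> bool" where
  "is_core_inverse a x \<longleftrightarrow>
     a * x * a = a \<and> right_principal x = right_principal a
     \<and> left_principal x = left_principal (a\<^sup>\<star>)"

definition is_dual_core_inverse :: "'a::star_ring \<Rightarrow> 'a \<Rightarrow> bool" where
  "is_dual_core_inverse a x \<longleftrightarrow>
     a * x * a = a \<and> right_principal x = right_principal (a\<^sup>\<star>)
     \<and> left_principal x = left_principal a"

definition invertible :: "'a::star_ring \<Rightarrow> bool" where
  "invertible a \<longleftrightarrow> (\<exists>x. is_two_sided_inverse a x)"

definition group_invertible :: "'a::star_ring \<Rightarrow> bool" where
  "group_invertible a \<longleftrightarrow> (\<exists>x. is_group_inverse a x)"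

definition mp_invertible :: "'a::star_ring \<Rightarrow> bool" where
  "mp_invertible a \<longleftrightarrow> (\<exists>x. is_mp_inverse a x)"

definition core_invertible :: "'a::star_ring \<Rightarrow> bool" where
  "core_invertible a \<longleftrightarrow> (\<exists>x. is_core_inverse a x)"

definition dual_core_invertible :: "'a::star_ring \<Rightarrow> bool" where
  "dual_core_invertible a \<longleftrightarrow> (\<exists>x. is_dual_core_inverse a x)"

text \<open>
  The following operators are meaningful only when the inverse in question exists;
  the uniqueness lemmas below show that they then denote it.
\<close>

definition unit_inv :: "'a::star_ring \<Rightarrow> 'a" where
  "unit_inv a = (THE x. is_two_sided_inverse a x)"

definition group_inv :: "'a::star_ring \<Rightarrow> 'a" where
  "group_inv a = (THE x. is_group_inverse a x)"

definition mp_inv :: "'a::star_ring \<Rightarrow> 'a" where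
  "mp_inv a = (THE x. is_mp_inverse a x)"

definition core_inv :: "'a::star_ring \<Rightarrow> 'a" where
  "core_inv a = (THE x. is_core_inverse a x)"

definition dual_core_inv :: "'a::star_ring \<Rightarrow> 'a" where
  "dual_core_inv a = (THE x. is_dual_core_inverse a x)"

lemma unit_inv_eq:
  assumes "is_two_sided_inverse a x"
  shows "unit_inv a = x"
proof -
  have "y = x" if "is_two_sided_inverse a y" for y
  proof -
    have x: "a * x = 1" and y: "y * a = 1"
      using assms that by (auto simp: is_two_sided_inverse_def)
    have "y = y * (a * x)" by (simp only: x mult_1_right)
    also have "\<dots> = x" by (simp only: mult.assoc[symmetric] y mult_1_left)
    finally show ?thesis .
  qed
  then show ?thesis
    unfolding unit_inv_def using assms by blast
qed

lemma group_inv_eq: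
  assumes "is_group_inverse a x"
  shows "group_inv a = x"
proof -
  have "y = x" if "is_group_inverse a y" for y
  proof -
    have x: "a * x * a = a" "x * a * x = x" "a * x = x * a"
      and y: "a * y * a = a" "y * a * y = y" "a * y = y * a"
      using assms that by (auto simp: is_group_inverse_def)
    have "a * y = (a * x) * (a * y)" by (simp only: mult.assoc[symmetric] x(1))
    also have "\<dots> = (x * a) * (y * a)" by (simp only: x(3) y(3))
    also have "\<dots> = x * (a * y * a)" by (simp only: mult.assoc)
    also have "\<dots> = x * a" by (simp only: y(1))
    also have "\<dots> = a * x" by (rule x(3)[symmetric])
    finally have 1: "a * y = a * x" .
    have "y = y * (a * y)" by (simp only: mult.assoc[symmetric] y(2))
    also have "\<dots> = (y * a) * x" unfolding 1 by (simp only: mult.assoc)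
    also have "\<dots> = (x * a) * x" unfolding y(3)[symmetric] 1 x(3) by (rule refl)
    also have "\<dots> = x" by (rule x(2))
    finally show ?thesis .
  qed
  then show ?thesis
    unfolding group_inv_def using assms by blast
qed

lemma mp_inv_eq:
  assumes "is_mp_inverse a x"
  shows "mp_inv a = x"
proof -
  have "y = x" if "is_mp_inverse a y" for y
  proof -
    have x: "a * x * a = a" "x * a * x = x" "(a * x)\<^sup>\<star> = a * x" "(x * a)\<^sup>\<star> = x * a"
      and y: "a * y * a = a" "y * a * y = y" "(a * y)\<^sup>\<star> = a * y" "(y * a)\<^sup>\<star> = y * a"
      using assms that by (auto simp: is_mp_inverse_def)
    have "a * y = (a * x) * (a * y)" by (simp only: mult.assoc[symmetric] x(1))
    also have "\<dots> = ((a * y) * (a * x))\<^sup>\<star>" by (simp only: star_mult[of "a * y" "a * x"] x(3) y(3))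
    also have "\<dots> = a * x" by (simp only: mult.assoc[symmetric] y(1) x(3))
    finally have 1: "a * y = a * x" .
    have "y * a = (y * a) * (x * a)" by (simp only: mult.assoc x(1)[unfolded mult.assoc])
    also have "\<dots> = ((x * a) * (y * a))\<^sup>\<star>" by (simp only: star_mult[of "x * a" "y * a"] x(4) y(4))
    also have "\<dots> = x * a" by (simp only: mult.assoc y(1)[unfolded mult.assoc] x(4))
    finally have 2: "y * a = x * a" .
    have "y = (y * a) * y" using y(2) by simp
    also have "\<dots> = x * (a * y)" by (simp only: 2 mult.assoc)
    also have "\<dots> = x" by (simp only: 1 mult.assoc[symmetric] x(2))
    finally show ?thesis .
  qed
  then show ?thesis
    unfolding mp_inv_def using assms by blast
qed

lemma core_inverse_equations:
  assumes "is_core_inverse a x"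
  shows "a * x * a = a" "x * a * x = x" "(a * x)\<^sup>\<star> = a * x" "x * a * a = a" "a * x * x = x"
proof -
  show i: "a * x * a = a"
    using assms by (simp add: is_core_inverse_def)
  have "x * 1 \<in> right_principal a"
    using assms unfolding is_core_inverse_def right_principal_def by blast
  then obtain r where r: "x = a * r"
    unfolding right_principal_def mult_1_right by blast
  have "a * 1 \<in> right_principal x"
    using assms unfolding is_core_inverse_def right_principal_def by blast
  then obtain s where s: "a = x * s"
    unfolding right_principal_def mult_1_right by blast
  have "1 * x \<in> left_principal (a\<^sup>\<star>)"
    using assms unfolding is_core_inverse_def left_principal_def by blast
  then obtain p where p: "x = p * a\<^sup>\<star>"
    unfolding left_principal_def mult_1_left by blast
  have "x = p * (a * x * a)\<^sup>\<star>" unfolding i by (rule p)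
  also have "\<dots> = (p * a\<^sup>\<star>) * (a * x)\<^sup>\<star>"
    by (simp only: star_mult[of "a * x" a] mult.assoc[of p])
  also have "\<dots> = x * (a * x)\<^sup>\<star>" by (simp only: p[symmetric])
  finally have x: "x = x * (a * x)\<^sup>\<star>" .
  from arg_cong[OF x, of "(*) a"] have e: "a * x = (a * x) * (a * x)\<^sup>\<star>"
    by (simp only: mult.assoc)
  show sym: "(a * x)\<^sup>\<star> = a * x"
  proof -
    have "(a * x)\<^sup>\<star> = ((a * x) * (a * x)\<^sup>\<star>)\<^sup>\<star>" by (rule arg_cong[OF e])
    also have "\<dots> = (a * x) * (a * x)\<^sup>\<star>" by (simp only: star_mult[of "a * x" "(a * x)\<^sup>\<star>"] star_star)
    also have "\<dots> = a * x" by (rule e[symmetric])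
    finally show ?thesis .
  qed
  show xax: "x * a * x = x" using x[symmetric] unfolding sym by (simp only: mult.assoc)
  show "x * a * a = a"
  proof -
    have "x * a * a = (x * a * x) * s" using arg_cong[OF s, of "(*) (x * a)"] by (simp only: mult.assoc)
    also have "\<dots> = a" unfolding xax by (rule s[symmetric])
    finally show ?thesis .
  qed
  show "a * x * x = x"
  proof -
    have "a * x * x = (a * x * a) * r" using arg_cong[OF r, of "(*) (a * x)"] by (simp only: mult.assoc)
    also have "\<dots> = x" unfolding i by (rule r[symmetric])
    finally show ?thesis .
  qed
qed

lemma core_inv_eq:
  assumes "is_core_inverse a x"
  shows "core_inv a = x"
proof -
  have "y = x" if "is_core_inverse a y" for y
  proof -
    note x = core_inverse_equations[OF assms] and y = core_inverse_equations[OF that]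
    have "a * y = (a * x) * (a * y)" by (simp only: mult.assoc[symmetric] x(1))
    also have "\<dots> = ((a * y) * (a * x))\<^sup>\<star>" by (simp only: star_mult[of "a * y" "a * x"] x(3) y(3))
    also have "\<dots> = a * x" by (simp only: mult.assoc[symmetric] y(1) x(3))
    finally have 1: "a * y = a * x" .
    have "y = a * y * y" using y(5) by simp
    also have "\<dots> = x * a * (a * y * y)" by (simp only: mult.assoc[symmetric] x(4))
    also have "\<dots> = x * (a * y)" by (simp only: y(5) mult.assoc[of x])
    also have "\<dots> = x" by (simp only: 1 mult.assoc[symmetric] x(2))
    finally show ?thesis .
  qed
  then show ?thesis
    unfolding core_inv_def using assms by blast
qed

lemma star_right_principal: "star ` right_principal a = left_principal (a\<^sup>\<star>)"
proof (intro set_eqI iffI)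
  fix y assume "y \<in> star ` right_principal a"
  then obtain r where "y = (a * r)\<^sup>\<star>" unfolding right_principal_def by blast
  then have "y = r\<^sup>\<star> * a\<^sup>\<star>" by (simp add: star_mult)
  then show "y \<in> left_principal (a\<^sup>\<star>)" unfolding left_principal_def by blast
next
  fix y assume "y \<in> left_principal (a\<^sup>\<star>)"
  then obtain r where "y = r * a\<^sup>\<star>" unfolding left_principal_def by blast
  then have "y = (a * r\<^sup>\<star>)\<^sup>\<star>" by (simp add: star_mult star_star)
  then show "y \<in> star ` right_principal a" unfolding right_principal_def by blast
qed

lemma star_left_principal: "star ` left_principal a = right_principal (a\<^sup>\<star>)"
proof (intro set_eqI iffI)
  fix y assume "y \<in> star ` left_principal a"
  then obtain r where "y = (r * a)\<^sup>\<star>" unfolding left_principal_def by blast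
  then have "y = a\<^sup>\<star> * r\<^sup>\<star>" by (simp add: star_mult)
  then show "y \<in> right_principal (a\<^sup>\<star>)" unfolding right_principal_def by blast
next
  fix y assume "y \<in> right_principal (a\<^sup>\<star>)"
  then obtain r where "y = a\<^sup>\<star> * r" unfolding right_principal_def by blast
  then have "y = (r\<^sup>\<star> * a)\<^sup>\<star>" by (simp add: star_mult star_star)
  then show "y \<in> star ` left_principal a" unfolding left_principal_def by blast
qed

lemma dual_core_inverse_star:
  assumes "is_dual_core_inverse a x"
  shows "is_core_inverse (a\<^sup>\<star>) (x\<^sup>\<star>)"
proof -
  have D: "a * x * a = a" "right_principal x = right_principal (a\<^sup>\<star>)"
    "left_principal x = left_principal a"
    using assms unfolding is_dual_core_inverse_def by blast+
  have "a\<^sup>\<star> * x\<^sup>\<star> * a\<^sup>\<star> = (a * x * a)\<^sup>\<star>"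
    by (simp only: star_mult mult.assoc)
  moreover have "right_principal (x\<^sup>\<star>) = right_principal (a\<^sup>\<star>)"
    by (simp only: star_left_principal[symmetric] D(3))
  moreover have "left_principal (x\<^sup>\<star>) = left_principal ((a\<^sup>\<star>)\<^sup>\<star>)"
    by (simp only: star_right_principal[symmetric] D(2))
  ultimately show ?thesis
    unfolding is_core_inverse_def D(1) by blast
qed

lemma dual_core_inv_eq:
  assumes "is_dual_core_inverse a x"
  shows "dual_core_inv a = x"
proof -
  have "y = x" if "is_dual_core_inverse a y" for y
    using core_inv_eq[OF dual_core_inverse_star[OF assms]]
      core_inv_eq[OF dual_core_inverse_star[OF that]]
    by (metis star_star)
  then show ?thesis
    unfolding dual_core_inv_def using assms by blast
qed

end

theory Submission
  imports Defs
begin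

text \<open>
  The four candidate units form two pairs of the shape \<open>1 + x * y\<close>, \<open>1 + y * x\<close>:
  with \<open>b = a\<^sup>\<star> * a - g\<close> and \<open>c = a * a\<^sup>\<star> - g\<close> one has \<open>u = 1 + a * b\<close>, \<open>s = 1 + b * a\<close>,
  \<open>v = 1 + c * a\<close>, \<open>t = 1 + a * c\<close>. So \<open>u\<close> and \<open>s\<close> are invertible together
  (lemma \<open>invertible_one_plus_mult_swap\<close>). Moreover the involution carries the \<open>u\<close> and \<open>s\<close>
  of the pair \<open>(a\<^sup>\<star>, g\<^sup>\<star>)\<close> to the \<open>v\<close> and \<open>t\<close> of \<open>(a, g)\<close>, and each notion of
  inverse is compatible with it. Everything is therefore proved for \<open>u\<close> and \<open>s\<close>, and the
  claims about \<open>v\<close> and \<open>t\<close> are the same claims for \<open>a\<^sup>\<star>\<close>.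

  The idempotent \<open>p = a * g\<close> generates the right ideal \<open>aR\<close>, and \<open>u\<close> is block triangular with
  respect to \<open>p\<close>, with diagonal blocks \<open>(a * a\<^sup>\<star>) * (a * p)\<close> and \<open>1 - p\<close>. If \<open>a\<close> has a
  group inverse and a Moore-Penrose inverse, both factors of the first block are invertible on
  \<open>aR\<close>, hence \<open>u\<close> is invertible (lemmas \<open>invertible_block_triangular\<close> and
  \<open>invertible_u\<close>). Conversely \<open>a * s = a * a\<^sup>\<star> * a\<^sup>2 = u * a\<close>; dividing by \<open>s\<close> on
  the right exhibits \<open>a\<close> as an element of \<open>a a\<^sup>\<star> a R\<close>, which yields the Moore-Penrose inverse and
  then \<open>a \<in> a\<^sup>2R\<close>, while dividing by \<open>u\<close> on the left gives \<open>a \<in> Ra\<^sup>2\<close>; the two memberships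
  give the group inverse, and the cofactors in these memberships furnish the stated formulas.
  Finally the core inverse is \<open>a\<^sup># a a\<^sup>\<dagger>\<close>, and \<open>u\<close> maps it to \<open>a * a\<^sup>\<star>\<close>.
\<close>

section \<open>Units and the involution\<close>

lemma star_one [simp]: "(1::'a::star_ring)\<^sup>\<star> = 1"
  by (metis mult_1_left mult_1_right star_mult star_star)

lemma star_diff: "(a - b)\<^sup>\<star> = a\<^sup>\<star> - (b::'a::star_ring)\<^sup>\<star>"
  by (metis add_diff_cancel_right' diff_add_cancel star_add)

lemma is_two_sided_inverse_star:
  "is_two_sided_inverse a x \<Longrightarrow> is_two_sided_inverse (a\<^sup>\<star>) (x\<^sup>\<star>)"
  unfolding is_two_sided_inverse_def by (metis star_mult star_one)

lemma invertible_star_iff: "invertible (a\<^sup>\<star>) \<longleftrightarrow> invertible a"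
  unfolding invertible_def by (metis is_two_sided_inverse_star star_star)

lemma is_two_sided_inverse_unit_inv:
  "invertible a \<Longrightarrow> is_two_sided_inverse a (unit_inv a)"
  unfolding invertible_def using unit_inv_eq by blast

lemma unit_inv_star: "invertible a \<Longrightarrow> unit_inv (a\<^sup>\<star>) = (unit_inv a)\<^sup>\<star>"
  by (intro unit_inv_eq is_two_sided_inverse_star is_two_sided_inverse_unit_inv)

text \<open>
  Jacobson's lemma: expanding \<open>(1 + b * a)\<inverse>\<close> formally as a geometric series suggests
  \<open>(1 + b * a)\<inverse> = 1 - b * (1 + a * b)\<inverse> * a\<close>, and this identity holds in every ring.
\<close>

lemma invertible_one_plus_mult_swap:
  fixes a b :: "'a::star_ring"
  assumes "invertible (1 + a * b)"
  shows "invertible (1 + b * a)"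
proof -
  obtain x where r: "(1 + a * b) * x = 1" and l: "x * (1 + a * b) = 1"
    using assms unfolding invertible_def is_two_sided_inverse_def by blast
  have "(1 + b * a) * (1 - b * x * a) = 1 + b * a - b * ((1 + a * b) * x) * a"
    by (simp add: algebra_simps)
  moreover have "(1 - b * x * a) * (1 + b * a) = 1 + b * a - b * (x * (1 + a * b)) * a"
    by (simp add: algebra_simps)
  ultimately show ?thesis
    unfolding invertible_def is_two_sided_inverse_def r l by auto
qed

text \<open>
  In the Peirce decomposition for \<open>p\<close>, the element \<open>w + 1 - p\<close> is block upper triangular with
  diagonal blocks \<open>w * p\<close> and \<open>1 - p\<close>; the element \<open>z\<close> inverts the former in the corner
  ring \<open>pRp\<close>.
\<close>

lemma invertible_block_triangular:
  fixes p w z :: "'a::star_ring"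
  assumes pp: "p * p = p" and pw: "p * w = w" and pz: "p * z = z" and zp: "z * p = z"
    and wz: "w * z = p" and zwp: "z * w * p = p"
  shows "invertible (w + 1 - p)"
proof -
  \<comment> \<open>the inverse of a triangular two-by-two matrix with lower right entry the identity\<close>
  let ?y = "z - z * w * (1 - p) + (1 - p)"
  have "(w + 1 - p) * ?y
      = w * z - w * z * w + w * z * w * p + w + 1 - p - w * p + (z - p * z)
        - (z - p * z) * w * (1 - p) + (p * p - p)"
    by (simp add: algebra_simps)
  also have "\<dots> = 1"
    by (simp add: wz pz pp pw algebra_simps)
  finally have r: "(w + 1 - p) * ?y = 1" .
  have "?y * (w + 1 - p)
      = z * w * p + 1 - p + (z - z * p) + (w - p * w) - z * w * (w - p * w)
        + z * w * (p - p * p) + (p * p - p)"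
    by (simp add: algebra_simps)
  also have "\<dots> = 1"
    by (simp add: zwp zp pp pw)
  finally have "?y * (w + 1 - p) = 1" .
  with r show ?thesis
    unfolding invertible_def is_two_sided_inverse_def by blast
qed

section \<open>Generalized inverses and the involution\<close>

lemma is_inner_inverse_star: "is_inner_inverse a x \<Longrightarrow> is_inner_inverse (a\<^sup>\<star>) (x\<^sup>\<star>)"
  unfolding is_inner_inverse_def by (metis star_mult mult.assoc)

lemma is_group_inverse_star: "is_group_inverse a x \<Longrightarrow> is_group_inverse (a\<^sup>\<star>) (x\<^sup>\<star>)"
  unfolding is_group_inverse_def by (metis star_mult mult.assoc)

lemma is_mp_inverse_star: "is_mp_inverse a x \<Longrightarrow> is_mp_inverse (a\<^sup>\<star>) (x\<^sup>\<star>)"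
  unfolding is_mp_inverse_def by (metis star_mult mult.assoc)

lemma is_dual_core_inverse_star_iff:
  "is_dual_core_inverse a x \<longleftrightarrow> is_core_inverse (a\<^sup>\<star>) (x\<^sup>\<star>)"
proof
  assume C: "is_core_inverse (a\<^sup>\<star>) (x\<^sup>\<star>)"
  have "(a * x * a)\<^sup>\<star> = a\<^sup>\<star>"
    using C unfolding is_core_inverse_def by (simp add: star_mult mult.assoc)
  then have "a * x * a = a"
    by (metis star_star)
  moreover have "right_principal x = right_principal (a\<^sup>\<star>)"
    using C star_left_principal[of "x\<^sup>\<star>"] star_left_principal[of a]
    unfolding is_core_inverse_def by (simp add: star_star)
  moreover have "left_principal x = left_principal a"
    using C star_right_principal[of "x\<^sup>\<star>"] star_right_principal[of "a\<^sup>\<star>"]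
    unfolding is_core_inverse_def by (simp add: star_star)
  ultimately show "is_dual_core_inverse a x"
    unfolding is_dual_core_inverse_def by blast
qed (rule dual_core_inverse_star)

section \<open>Existence of group and Moore-Penrose inverses\<close>

text \<open>
  Evaluating \<open>y * a * a * x\<close> in two ways gives \<open>a * x = y * a\<close>. Hence \<open>a * x\<^sup>2 = y\<^sup>2 * a\<close>,
  and multiplying this element by \<open>a\<close> on either side yields \<open>a * x\<close>.
\<close>

lemma is_group_inverse_of_factorizations:
  fixes a x y :: "'a::star_ring"
  assumes x: "a = a * a * x" and y: "a = y * (a * a)"
  shows "is_group_inverse a (a * x ^ 2)"
proof -
  have ax: "a * x = y * a"
    using x y by (metis mult.assoc)
  have l: "a * (a * x ^ 2) = a * x"
    using x by (metis mult.assoc power2_eq_square)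
  have "a * x ^ 2 = y * (y * a)"
    by (metis ax mult.assoc power2_eq_square)
  then have r: "(a * x ^ 2) * a = a * x"
    using y ax by (metis mult.assoc)
  have axa: "a * x * a = a"
    using y ax by (metis mult.assoc)
  have "a * x ^ 2 * a * (a * x ^ 2) = a * x * a * x ^ 2"
    unfolding r by (simp add: mult.assoc)
  then show ?thesis
    unfolding is_group_inverse_def using l r axa by simp
qed

text \<open>
  The factorization forces \<open>(a * r)\<^sup>\<star> * a = r\<^sup>\<star> * (a\<^sup>\<star> * a) * (a\<^sup>\<star> * a) * r\<close>, which is visibly
  self-adjoint; this turns the starred factorization into \<open>a = a * (a * r)\<^sup>\<star> * a\<close>, and then
  \<open>a * (a * r)\<^sup>\<star>\<close> has the self-adjoint form \<open>q\<^sup>\<star> * (a\<^sup>\<star> * a) * q\<close> with \<open>q = r * a\<^sup>\<star>\<close>.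
\<close>

lemma is_mp_inverse_of_factorization:
  fixes a r :: "'a::star_ring"
  assumes r: "a = a * a\<^sup>\<star> * a * r"
  shows "is_mp_inverse a ((a * r)\<^sup>\<star>)"
proof -
  let ?y = "r\<^sup>\<star> * a\<^sup>\<star>"
  have st: "a\<^sup>\<star> = ?y * a * a\<^sup>\<star>"
    using arg_cong[OF r, of star] by (simp add: star_mult star_star mult.assoc)
  have "?y * a = ?y * (a * a\<^sup>\<star> * a * r)"
    using r by simp
  also have "\<dots> = r\<^sup>\<star> * (a\<^sup>\<star> * a * a\<^sup>\<star> * a) * r"
    by (simp add: mult.assoc)
  finally have ya_eq: "?y * a = r\<^sup>\<star> * (a\<^sup>\<star> * a * a\<^sup>\<star> * a) * r" .
  have ya: "(?y * a)\<^sup>\<star> = ?y * a"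
    unfolding ya_eq by (simp add: star_mult star_star mult.assoc)
  have aya: "a * ?y * a = a"
    using arg_cong[OF st, of star] ya by (metis star_mult star_star mult.assoc)
  have "a * ?y = a * r\<^sup>\<star> * (a * ?y * a)\<^sup>\<star>"
    unfolding aya by (simp add: mult.assoc)
  also have "\<dots> = a * (r\<^sup>\<star> * (a\<^sup>\<star> * a) * r) * a\<^sup>\<star>"
    by (simp add: star_mult star_star mult.assoc)
  finally have ay_eq: "a * ?y = a * (r\<^sup>\<star> * (a\<^sup>\<star> * a) * r) * a\<^sup>\<star>" .
  have ay: "(a * ?y)\<^sup>\<star> = a * ?y"
    unfolding ay_eq by (simp add: star_mult star_star mult.assoc)
  have "a\<^sup>\<star> * (a * ?y) = a\<^sup>\<star>"
    by (metis aya ay star_mult)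
  then have "?y * a * ?y = ?y"
    by (simp add: mult.assoc)
  then show ?thesis
    unfolding is_mp_inverse_def star_mult[of a r] using ya aya ay by blast
qed

section \<open>Core inverses\<close>

text \<open>
  The factor \<open>x = a * x * x\<close> fixes the right ideal of \<open>x * a * y\<close>, and the projection
  \<open>a * y = y\<^sup>\<star> * a\<^sup>\<star>\<close> fixes its left ideal.
\<close>

lemma is_core_inverse_of_group_mp:
  fixes a x y :: "'a::star_ring"
  assumes "is_group_inverse a x" and "is_mp_inverse a y"
  shows "is_core_inverse a (x * a * y)"
proof -
  have x: "a * x * a = a" "x * a * x = x" "a * x = x * a"
    using assms(1) unfolding is_group_inverse_def by auto
  have y: "a * y * a = a" "(a * y)\<^sup>\<star> = a * y"
    using assms(2) unfolding is_mp_inverse_def by auto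
  let ?c = "x * a * y"
  have 1: "a * ?c * a = a"
    using x(1) y(1) by (metis mult.assoc)
  have c: "?c = a * (x * y)"
    by (metis x(3) mult.assoc)
  have a: "a = ?c * (a * a)"
    using x y(1) by (metis mult.assoc)
  have "right_principal ?c \<subseteq> right_principal a"
    unfolding right_principal_def using c by (fastforce simp: mult.assoc)
  moreover have "right_principal a \<subseteq> right_principal ?c"
    unfolding right_principal_def using a by (smt (verit) mem_Collect_eq subsetI mult.assoc)
  moreover have c': "?c = (x * y\<^sup>\<star>) * a\<^sup>\<star>"
    by (metis y(2) star_mult mult.assoc)
  have "left_principal ?c \<subseteq> left_principal (a\<^sup>\<star>)"
    unfolding left_principal_def using c' by (smt (verit) mem_Collect_eq subsetI mult.assoc)
  moreover have a': "a\<^sup>\<star> = (a\<^sup>\<star> * a) * ?c"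
    by (metis x(1) y star_mult mult.assoc)
  have "left_principal (a\<^sup>\<star>) \<subseteq> left_principal ?c"
    unfolding left_principal_def using a' by (smt (verit) mem_Collect_eq subsetI mult.assoc)
  ultimately show ?thesis
    unfolding is_core_inverse_def using 1 by blast
qed

lemma is_group_inverse_of_core:
  assumes "is_core_inverse a x"
  shows "is_group_inverse a (x * x * a)"
  using core_inverse_equations[OF assms] unfolding is_group_inverse_def
  by (metis mult.assoc)

text \<open>
  The core inverse supplies a self-adjoint \<open>a * x\<close> and the dual core inverse a self-adjoint
  \<open>y * a\<close>; the product \<open>y * a * x\<close> inherits both.
\<close>

lemma is_mp_inverse_of_core_dual_core:
  assumes "is_core_inverse a x" and "is_dual_core_inverse a y"
  shows "is_mp_inverse a (y * a * x)"
proof -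
  note x = core_inverse_equations[OF assms(1)]
  have y: "a * y * a = a"
    using assms(2) by (simp add: is_dual_core_inverse_def)
  have "(y * a)\<^sup>\<star> = y * a"
    using core_inverse_equations(3)[OF dual_core_inverse_star[OF assms(2)]]
    by (metis star_mult star_star)
  moreover have "a * (y * a * x) = a * x" "(y * a * x) * a = y * a"
    using x(1) y by (metis mult.assoc)+
  ultimately show ?thesis
    unfolding is_mp_inverse_def using x y by (metis mult.assoc)
qed

lemma core_dual_core_invertible_iff:
  fixes a :: "'a::star_ring"
  shows "core_invertible a \<and> dual_core_invertible a \<longleftrightarrow> group_invertible a \<and> mp_invertible a"
proof
  assume "group_invertible a \<and> mp_invertible a"
  then obtain x y where x: "is_group_inverse a x" and y: "is_mp_inverse a y"
    unfolding group_invertible_def mp_invertible_def by blast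
  have "is_core_inverse (a\<^sup>\<star>) (x\<^sup>\<star> * a\<^sup>\<star> * y\<^sup>\<star>)"
    by (intro is_core_inverse_of_group_mp is_group_inverse_star is_mp_inverse_star x y)
  then have "is_dual_core_inverse a ((x\<^sup>\<star> * a\<^sup>\<star> * y\<^sup>\<star>)\<^sup>\<star>)"
    by (simp only: is_dual_core_inverse_star_iff star_star)
  then show "core_invertible a \<and> dual_core_invertible a"
    unfolding core_invertible_def dual_core_invertible_def
    using is_core_inverse_of_group_mp[OF x y] by blast
next
  assume "core_invertible a \<and> dual_core_invertible a"
  then show "group_invertible a \<and> mp_invertible a"
    unfolding core_invertible_def dual_core_invertible_def group_invertible_def mp_invertible_def
    using is_group_inverse_of_core is_mp_inverse_of_core_dual_core by blast
qed

section \<open>The units u and s\<close>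

text \<open>
  On \<open>aR\<close> the factors \<open>a * a\<^sup>\<star>\<close> and \<open>a\<close> of \<open>a * a\<^sup>\<star> * a\<close> are inverted by \<open>y\<^sup>\<star> * y\<close> and
  \<open>x\<close> respectively, so \<open>x * y\<^sup>\<star> * y\<close>, cut down to the corner of \<open>a * g\<close>, inverts the
  diagonal block.
\<close>

lemma invertible_u:
  fixes a g x y :: "'a::star_ring"
  assumes "is_inner_inverse a g" and "is_group_inverse a x" and "is_mp_inverse a y"
  shows "invertible (a * a\<^sup>\<star> * a + 1 - a * g)"
proof (rule invertible_block_triangular)
  have g: "a * g * a = a"
    using assms(1) unfolding is_inner_inverse_def .
  have x: "a * x * a = a" "x * a * x = x" "a * x = x * a"
    using assms(2) unfolding is_group_inverse_def by auto
  have y: "a * y * a = a" "y * a * y = y" "(a * y)\<^sup>\<star> = a * y" "(y * a)\<^sup>\<star> = y * a"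
    using assms(3) unfolding is_mp_inverse_def by auto
  let ?z = "x * y\<^sup>\<star> * y * (a * g)"
  show "a * g * (a * g) = a * g" "a * g * (a * a\<^sup>\<star> * a) = a * a\<^sup>\<star> * a"
    by (metis g mult.assoc)+
  show "?z * (a * g) = ?z"
    by (metis g mult.assoc)
  have gx: "a * g * x = x"
    by (metis g x mult.assoc)
  then show "a * g * ?z = ?z"
    by (metis mult.assoc)
  have "y\<^sup>\<star> = a * y * y\<^sup>\<star>"
    by (metis y(2,3) star_mult mult.assoc)
  then have axy: "a * x * y\<^sup>\<star> = y\<^sup>\<star>"
    by (metis x(1) mult.assoc)
  have "a * a\<^sup>\<star> * a * ?z = a * a\<^sup>\<star> * (a * x * y\<^sup>\<star>) * y * a * g"
    by (simp add: mult.assoc)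
  also have "\<dots> = a * (y * a)\<^sup>\<star> * y * a * g"
    unfolding axy by (simp add: star_mult mult.assoc)
  also have "\<dots> = a * g"
    unfolding y(4) by (metis y(1) mult.assoc)
  finally show "a * a\<^sup>\<star> * a * ?z = a * g" .
  have yy: "y\<^sup>\<star> * y * a * a\<^sup>\<star> = a * y"
    by (metis y(1,3,4) star_mult mult.assoc)
  have "?z * (a * a\<^sup>\<star> * a) * (a * g) = x * y\<^sup>\<star> * y * (a * g * a) * a\<^sup>\<star> * a * a * g"
    by (simp add: mult.assoc)
  also have "\<dots> = x * (y\<^sup>\<star> * y * a * a\<^sup>\<star>) * a * a * g"
    unfolding g by (simp add: mult.assoc)
  also have "\<dots> = a * g"
    unfolding yy by (metis x(1,3) y(1) mult.assoc)
  finally show "?z * (a * a\<^sup>\<star> * a) * (a * g) = a * g" .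
qed

lemma invertible_u_iff_invertible_s:
  fixes a g :: "'a::star_ring"
  shows "invertible (a * a\<^sup>\<star> * a + 1 - a * g) \<longleftrightarrow> invertible (a\<^sup>\<star> * a ^ 2 + 1 - g * a)"
proof -
  have u: "a * a\<^sup>\<star> * a + 1 - a * g = 1 + a * (a\<^sup>\<star> * a - g)"
    and s: "a\<^sup>\<star> * a ^ 2 + 1 - g * a = 1 + (a\<^sup>\<star> * a - g) * a"
    by (simp_all add: algebra_simps power2_eq_square)
  show ?thesis
    unfolding u s by (blast intro: invertible_one_plus_mult_swap)
qed

text \<open>
  The inner inverse cancels in \<open>a * s = a * a\<^sup>\<star> * a\<^sup>2 = u * a\<close>. The first equation
  gives \<open>a = a * a\<^sup>\<star> * a * r\<close> with \<open>r = a * s\<inverse>\<close>, so that \<open>a * r\<close> is the adjoint of the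
  Moore-Penrose inverse. Since \<open>a = (a * r) * (a\<^sup>\<star> * a)\<close> and \<open>a * r = a\<^sup>2 * s\<inverse>\<close>, the element
  \<open>a\<close> lies in \<open>a\<^sup>2R\<close>; the second equation puts it in \<open>Ra\<^sup>2\<close>.
\<close>

lemma mp_group_inverse_of_invertible_s:
  fixes a g :: "'a::star_ring"
  assumes g: "is_inner_inverse a g"
    and inv: "invertible (a\<^sup>\<star> * a ^ 2 + 1 - g * a)" (is "invertible ?s")
  shows "is_mp_inverse a ((a ^ 2 * unit_inv ?s)\<^sup>\<star>)"
    and "is_group_inverse a (a * (unit_inv ?s * a\<^sup>\<star> * a) ^ 2)"
proof -
  let ?u = "a * a\<^sup>\<star> * a + 1 - a * g" and ?m = "unit_inv ?s"
  have g': "a * (g * a) = a"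
    using g unfolding is_inner_inverse_def by (simp add: mult.assoc)
  have m: "?s * ?m = 1"
    using is_two_sided_inverse_unit_inv[OF inv] by (simp add: is_two_sided_inverse_def)
  obtain n where n: "n * ?u = 1"
    using inv invertible_u_iff_invertible_s[of a g]
    unfolding invertible_def is_two_sided_inverse_def by blast
  have "a = a * ?s * ?m"
    by (simp only: mult.assoc m mult_1_right)
  also have "a * ?s = a * a\<^sup>\<star> * a * a"
    by (simp add: algebra_simps power2_eq_square g')
  finally have "is_mp_inverse a ((a * (a * ?m))\<^sup>\<star>)"
    by (intro is_mp_inverse_of_factorization) (simp only: mult.assoc)
  then show mp: "is_mp_inverse a ((a ^ 2 * ?m)\<^sup>\<star>)"
    by (simp only: power2_eq_square mult.assoc)
  then have "a = (a * (a ^ 2 * ?m)\<^sup>\<star>)\<^sup>\<star> * a"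
    unfolding is_mp_inverse_def by simp
  then have right: "a = a * a * (?m * a\<^sup>\<star> * a)"
    by (simp add: star_mult star_star power2_eq_square mult.assoc)
  have "a = n * (?u * a)"
    by (simp only: mult.assoc[symmetric] n mult_1_left)
  also have "?u * a = a * a\<^sup>\<star> * (a * a)"
    by (simp add: algebra_simps g')
  finally have "a = n * (a * a\<^sup>\<star>) * (a * a)"
    by (simp only: mult.assoc)
  with right show "is_group_inverse a (a * (?m * a\<^sup>\<star> * a) ^ 2)"
    by (rule is_group_inverse_of_factorizations)
qed

lemma group_mp_invertible_iff:
  fixes a g :: "'a::star_ring"
  assumes "is_inner_inverse a g"
  shows "group_invertible a \<and> mp_invertible a \<longleftrightarrow> invertible (a * a\<^sup>\<star> * a + 1 - a * g)"
    and "group_invertible a \<and> mp_invertible a \<longleftrightarrow> invertible (a\<^sup>\<star> * a ^ 2 + 1 - g * a)"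
  using invertible_u[OF assms] mp_group_inverse_of_invertible_s[OF assms]
    invertible_u_iff_invertible_s[of a g]
  unfolding group_invertible_def mp_invertible_def by blast+

text \<open>
  Multiplying the core inverse \<open>c\<close> by \<open>u\<close> gives \<open>a * a\<^sup>\<star>\<close>: the term \<open>1 - a * g\<close> annihilates
  \<open>c \<in> aR\<close>, and \<open>a\<^sup>\<star> * (a * c) = a\<^sup>\<star>\<close> because \<open>a * c\<close> is self-adjoint.
\<close>

lemma is_core_inverse_unit_inv:
  fixes a g :: "'a::star_ring"
  assumes g: "is_inner_inverse a g" and ga: "group_invertible a" and mp: "mp_invertible a"
  shows "is_core_inverse a (unit_inv (a * a\<^sup>\<star> * a + 1 - a * g) * a * a\<^sup>\<star>)"
proof -
  let ?u = "a * a\<^sup>\<star> * a + 1 - a * g"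
  have "invertible ?u"
    using group_mp_invertible_iff(1)[OF g] ga mp by blast
  then have u: "unit_inv ?u * ?u = 1"
    using is_two_sided_inverse_unit_inv unfolding is_two_sided_inverse_def by blast
  obtain c where c: "is_core_inverse a c"
    using core_dual_core_invertible_iff ga mp unfolding core_invertible_def by blast
  note eqs = core_inverse_equations[OF c]
  have agc: "a * g * c = c"
    using g eqs(5) unfolding is_inner_inverse_def by (metis mult.assoc)
  have "a\<^sup>\<star> * (a * c) = a\<^sup>\<star>"
    by (metis eqs(1,3) star_mult)
  then have "?u * c = a * a\<^sup>\<star>"
    using agc by (simp add: algebra_simps)
  then have "c = unit_inv ?u * a * a\<^sup>\<star>"
    by (metis u mult.assoc mult_1_left)
  with c show ?thesis by simp
qed

section \<open>The characterizations and formulas\<close>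

lemma group_mp_invertible_star_iff:
  "group_invertible (a\<^sup>\<star>) \<and> mp_invertible (a\<^sup>\<star>) \<longleftrightarrow> group_invertible a \<and> mp_invertible a"
  unfolding group_invertible_def mp_invertible_def
  by (metis is_group_inverse_star is_mp_inverse_star star_star)

theorem theorem5p6:
  fixes a g u v s t :: "'a::star_ring"
  assumes "is_inner_inverse a g"
    and "u = a * a\<^sup>\<star> * a + 1 - a * g"
    and "v = a * a\<^sup>\<star> * a + 1 - g * a"
    and "s = a\<^sup>\<star> * a ^ 2 + 1 - g * a"
    and "t = a ^ 2 * a\<^sup>\<star> + 1 - a * g"
  shows
    "((group_invertible a \<and> mp_invertible a) \<longleftrightarrow> (core_invertible a \<and> dual_core_invertible a))
     \<and> ((group_invertible a \<and> mp_invertible a) \<longleftrightarrow> invertible u)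
     \<and> ((group_invertible a \<and> mp_invertible a) \<longleftrightarrow> invertible v)
     \<and> ((group_invertible a \<and> mp_invertible a) \<longleftrightarrow> invertible s)
     \<and> ((group_invertible a \<and> mp_invertible a) \<longleftrightarrow> invertible t)
     \<and> ((group_invertible a \<and> mp_invertible a) \<longrightarrow>
          core_inv a = unit_inv u * a * a\<^sup>\<star>
          \<and> dual_core_inv a = a\<^sup>\<star> * a * unit_inv v
          \<and> mp_inv a = (unit_inv t * a ^ 2)\<^sup>\<star>
          \<and> mp_inv a = (a ^ 2 * unit_inv s)\<^sup>\<star>
          \<and> group_inv a = (a * a\<^sup>\<star> * unit_inv t) ^ 2 * a
          \<and> group_inv a = a * (unit_inv s * a\<^sup>\<star> * a) ^ 2)"
proof -
  let ?P = "group_invertible a \<and> mp_invertible a"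
  note g = assms(1) and g' = is_inner_inverse_star[OF assms(1)]
  have v': "v\<^sup>\<star> = a\<^sup>\<star> * (a\<^sup>\<star>)\<^sup>\<star> * a\<^sup>\<star> + 1 - a\<^sup>\<star> * g\<^sup>\<star>"
    and t': "t\<^sup>\<star> = (a\<^sup>\<star>)\<^sup>\<star> * (a\<^sup>\<star>) ^ 2 + 1 - g\<^sup>\<star> * a\<^sup>\<star>"
    unfolding assms(3,5)
    by (simp_all add: star_add star_diff star_mult star_star power2_eq_square mult.assoc)
  have u: "?P \<longleftrightarrow> invertible u" and s: "?P \<longleftrightarrow> invertible s"
    unfolding assms(2,4) by (rule group_mp_invertible_iff[OF g])+
  have v: "?P \<longleftrightarrow> invertible v"
    using group_mp_invertible_iff(1)[OF g', folded v']
    by (simp only: group_mp_invertible_star_iff invertible_star_iff)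
  have t: "?P \<longleftrightarrow> invertible t"
    using group_mp_invertible_iff(2)[OF g', folded t']
    by (simp only: group_mp_invertible_star_iff invertible_star_iff)
  have "core_inv a = unit_inv u * a * a\<^sup>\<star>
      \<and> dual_core_inv a = a\<^sup>\<star> * a * unit_inv v
      \<and> mp_inv a = (unit_inv t * a ^ 2)\<^sup>\<star>
      \<and> mp_inv a = (a ^ 2 * unit_inv s)\<^sup>\<star>
      \<and> group_inv a = (a * a\<^sup>\<star> * unit_inv t) ^ 2 * a
      \<and> group_inv a = a * (unit_inv s * a\<^sup>\<star> * a) ^ 2" if P: ?P
  proof (intro conjI)
    have P': "group_invertible (a\<^sup>\<star>)" "mp_invertible (a\<^sup>\<star>)"
      using P group_mp_invertible_star_iff[of a] by auto
    have iv: "unit_inv (v\<^sup>\<star>) = (unit_inv v)\<^sup>\<star>" and it: "unit_inv (t\<^sup>\<star>) = (unit_inv t)\<^sup>\<star>"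
      using P v t by (blast intro: unit_inv_star)+
    have t_inv: "invertible (t\<^sup>\<star>)"
      using P t invertible_star_iff by blast
    show "core_inv a = unit_inv u * a * a\<^sup>\<star>"
      unfolding assms(2) using P g by (blast intro: core_inv_eq is_core_inverse_unit_inv)
    have "is_core_inverse (a\<^sup>\<star>) ((unit_inv v)\<^sup>\<star> * a\<^sup>\<star> * a)"
      using is_core_inverse_unit_inv[OF g' P', folded v'] by (simp only: iv star_star)
    then show "dual_core_inv a = a\<^sup>\<star> * a * unit_inv v"
      by (intro dual_core_inv_eq)
        (simp add: is_dual_core_inverse_star_iff star_mult star_star mult.assoc)
    show "mp_inv a = (a ^ 2 * unit_inv s)\<^sup>\<star>"
      and "group_inv a = a * (unit_inv s * a\<^sup>\<star> * a) ^ 2"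
      using mp_group_inverse_of_invertible_s[OF g] P s unfolding assms(4)
      by (blast intro: mp_inv_eq group_inv_eq)+
    note star_t = mp_group_inverse_of_invertible_s[OF g', folded t', OF t_inv]
    show "mp_inv a = (unit_inv t * a ^ 2)\<^sup>\<star>"
      using is_mp_inverse_star[OF star_t(1)]
      by (intro mp_inv_eq) (simp add: it star_mult star_star power2_eq_square mult.assoc)
    show "group_inv a = (a * a\<^sup>\<star> * unit_inv t) ^ 2 * a"
      using is_group_inverse_star[OF star_t(2)]
      by (intro group_inv_eq) (simp add: it star_mult star_star power2_eq_square mult.assoc)
  qed
  with u s v t core_dual_core_invertible_iff[of a] show ?thesis
    by blast
qed

end
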